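(* For all $x\in\Delta_n$, $$\mathrm{dist}_{\|\cdot\|}(x,\mathcal{X}^* ) \le \frac{\sqrt{p_{\min}\,\omega\big(p_{\min}^{-1/2}R_{y^*}\big)}}{C_{\rm H} R_{y^*}}\,\sqrt{f^*-f(x)}.$$
   Context: Let $m,n$ be positive integers, $[n]=\{1,\dots,n\}$, and $\Delta_n=\{x\in\mathbb{R}^n: x\ge 0,\ \sum_{i=1}^n x_i=1\}$. Let $p_1,\dots,p_m>0$ with $\sum_{j=1}^m p_j=1$, $p_{\min}=\min_{j} p_j$, and let $a_1,\dots,a_m\in\mathbb{R}^n$ be entrywise nonnegative and nonzero. Let $A$ be the $m\times n$ matrix with rows $a_j^\top$ and columns $A_1,\dots,A_n$. Let $f(x)=\sum_{j=1}^m p_j\ln(a_j^\top x)$ (with $\ln 0=-\infty$), $f^*=\max_{x\in\Delta_n} f(x)$, and let $\mathcal{X}^*\neq\emptyset$ be the set of maximizers of $f$ over $\Delta_n$. Let $\bar f(y)=\sum_{j=1}^m p_j\ln y_j$ and $\mathcal{Y}=A(\Delta_n)=\{Ax:x\in\Delta_n\}$; $y^*$ denotes the unique maximizer of $\bar f$ over $\mathcal{Y}$ (it has all entries positive, $\bar f(y^* )=f^*$, and $\mathcal{X}^*=\{x\in\Delta_n:Ax=y^*\}$). Define $\|y\|_{y^*}=\sqrt{\sum_{j=1}^m p_j(y_j/y_j^* )^2}$ for $y\in\mathbb{R}^m$, and $R_{y^*}=\max_{y\in\mathcal{Y}}\|y-y^*\|_{y^*}=\max_{i\in[n]}\|A_i-y^*\|_{y^*}$.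 Define $\omega(t)=t-\ln(1+t)$ for $t>-1$. Let $\|\cdot\|$ be any given norm on $\mathbb{R}^n$ and $\mathrm{dist}_{\|\cdot\|}(x,\mathcal{X}^* )=\min_{x^*\in\mathcal{X}^*}\|x-x^*\|$. $C_{\rm H}$ is a (Hoffman) constant with $0<C_{\rm H}<+\infty$ such that $\mathrm{dist}_{\|\cdot\|}(x,\mathcal{X}^* )\le C_{\rm H}\|Ax-y^*\|_{y^*}$ for all $x\in\Delta_n$ (such a constant exists).
   Formalization: The printed coefficient is inverted and the inequality is false (e.g. m=1, n=2, a=(1,2), sup norm, C_H=2, x=e_1); what is proved has the reciprocal coefficient C_H R_{y*} / sqrt(p_min ω(p_min^{-1/2} R_{y*})) in front of sqrt(f*-f(x)). *)

theory Defs
  imports "HOL-Analysis.Analysis"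
begin

definition prob_simplex :: "(real ^ 'n) set" where
  "prob_simplex = {x. (\<forall>i. 0 \<le> x $ i) \<and> (\<Sum>i\<in>UNIV. x $ i) = 1}"

text \<open>The library logarithm satisfies \<open>ln 0 = 0\<close>; the objective needs \<open>ln 0 = -\<infinity>\<close>, hence
  extended real values. The junk value for negative arguments never occurs below.\<close>

definition eln :: "real \<Rightarrow> ereal" where
  "eln t = (if 0 < t then ereal (ln t) else -\<infinity>)"

text \<open>Used only on nonnegative arguments, where \<open>sqrt \<infinity> = \<infinity>\<close>.\<close>

definition esqrt :: "ereal \<Rightarrow> ereal" where
  "esqrt t = (if t = \<infinity> then \<infinity> else ereal (sqrt (real_of_ereal t)))"

definition fbar :: "real ^ 'm \<Rightarrow> real ^ 'm \<Rightarrow> ereal" where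
  "fbar p y = (\<Sum>j\<in>UNIV. ereal (p $ j) * eln (y $ j))"

text \<open>\<open>A $ j\<close> is the \<open>j\<close>-th row of \<open>A\<close>.\<close>

definition fobj :: "real ^ 'm \<Rightarrow> real ^ 'n ^ 'm \<Rightarrow> real ^ 'n \<Rightarrow> ereal" where
  "fobj p A x = (\<Sum>j\<in>UNIV. ereal (p $ j) * eln (A $ j \<bullet> x))"

text \<open>The supremum is attained when the rows of \<open>A\<close> are nonnegative and nonzero and \<open>p\<close> is positive.\<close>

definition fstar :: "real ^ 'm \<Rightarrow> real ^ 'n ^ 'm \<Rightarrow> ereal" where
  "fstar p A = (SUP x\<in>prob_simplex. fobj p A x)"

definition Xstar :: "real ^ 'm \<Rightarrow> real ^ 'n ^ 'm \<Rightarrow> (real ^ 'n) set" where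
  "Xstar p A = {x. is_arg_max (fobj p A) (\<lambda>x. x \<in> prob_simplex) x}"

definition Yset :: "real ^ 'n ^ 'm \<Rightarrow> (real ^ 'm) set" where
  "Yset A = (\<lambda>x. A *v x) ` prob_simplex"

definition ystar :: "real ^ 'm \<Rightarrow> real ^ 'n ^ 'm \<Rightarrow> real ^ 'm" where
  "ystar p A = (THE y. is_arg_max (fbar p) (\<lambda>y. y \<in> Yset A) y)"

definition local_norm :: "real ^ 'm \<Rightarrow> real ^ 'm \<Rightarrow> real ^ 'm \<Rightarrow> real" where
  "local_norm p z y = sqrt (\<Sum>j\<in>UNIV. p $ j * (y $ j / z $ j)\<^sup>2)"

text \<open>The supremum is a maximum, as \<open>Yset A\<close> is compact and nonempty.\<close>

definition radius :: "real ^ 'm \<Rightarrow> real ^ 'n ^ 'm \<Rightarrow> real" where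
  "radius p A = (SUP y\<in>Yset A. local_norm p (ystar p A) (y - ystar p A))"

definition pmin :: "real ^ 'm \<Rightarrow> real" where
  "pmin p = Min (range (\<lambda>j. p $ j))"

definition \<omega> :: "real \<Rightarrow> real" where
  "\<omega> t = t - ln (1 + t)"

definition is_norm :: "('a::real_vector \<Rightarrow> real) \<Rightarrow> bool" where
  "is_norm N \<longleftrightarrow> (\<forall>x. 0 \<le> N x) \<and> (\<forall>x. N x = 0 \<longleftrightarrow> x = 0) \<and>
     (\<forall>c x. N (c *\<^sub>R x) = \<bar>c\<bar> * N x) \<and> (\<forall>x y. N (x + y) \<le> N x + N y)"

text \<open>The library's \<open>infdist\<close> is tied to the Euclidean metric, so it cannot be used for an
  arbitrary norm. On the nonempty compact set of maximizers the infimum is a minimum.\<close>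

definition norm_dist :: "('a::real_vector \<Rightarrow> real) \<Rightarrow> 'a \<Rightarrow> 'a set \<Rightarrow> real" where
  "norm_dist N x S = (INF z\<in>S. N (x - z))"

end

theory Submission
  imports Defs
begin

text \<open>Put \<open>d = (A x - y\<^sup>*) / y\<^sup>*\<close> entrywise. First-order optimality of \<open>y\<^sup>*\<close> gives
  \<open>\<Sum>j. p j * d j \<le> 0\<close>, so \<open>f\<^sup>* - f x = - (\<Sum>j. p j * ln (1 + d j)) \<ge> (\<Sum>j. p j * \<omega> (d j))\<close>.
  Since \<open>\<omega> t / t\<^sup>2\<close> is nonincreasing and \<open>d j \<le> R / sqrt p\<^sub>m\<^sub>i\<^sub>n =: T\<close>, the right-hand side is
  at least \<open>\<omega> T / T\<^sup>2\<close> times the squared local norm of \<open>A x - y\<^sup>*\<close>, and Hoffman's bound applies.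
  The maximizer \<open>y\<^sup>*\<close> is obtained by maximizing the weighted geometric mean, a continuous
  real-valued function even on the boundary of the orthant.\<close>

section \<open>Calculus of the function \<open>\<omega>\<close>\<close>

lemma two_ln_le_diff_inverse:
  fixes u :: real
  assumes "1 \<le> u"
  shows "2 * ln u \<le> u - 1 / u"
proof -
  \<comment> \<open>The left side is the value at 1, namely 0. The derivative is a perfect square,
    so the difference never decreases.\<close>
  have "1 - 1 / 1 - 2 * ln 1 \<le> u - 1 / u - 2 * ln u"
  proof (rule DERIV_nonneg_imp_nondecreasing[OF assms])
    fix x :: real assume x: "1 \<le> x" "x \<le> u"
    have "((\<lambda>x. x - 1 / x - 2 * ln x) has_real_derivative (1 - 1 / x)\<^sup>2) (at x)"
      using x by (auto intro!: derivative_eq_intros simp: field_simps power2_eq_square)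
    then show "\<exists>y. ((\<lambda>x. x - 1 / x - 2 * ln x) has_real_derivative y) (at x) \<and> 0 \<le> y"
      by force
  qed
  then show ?thesis by simp
qed

lemma omega_nonneg: "-1 < t \<Longrightarrow> 0 \<le> \<omega> t"
  using ln_add_one_self_le_self2[of t] by (simp add: \<omega>_def)

lemma omega_eq_0_iff: "-1 < t \<Longrightarrow> \<omega> t = 0 \<longleftrightarrow> t = 0"
  using ln_eq_minus_one[of "1 + t"] by (auto simp: \<omega>_def)

text \<open>The difference of the two sides vanishes at 0 and has derivative
  \<open>x\<^sup>2 / (1 + x)\<close>. The same derivative, read to the left of 0, gives the reverse
  inequality there.\<close>

lemma omega_le_half_square:
  assumes "0 \<le> t"
  shows "\<omega> t \<le> t\<^sup>2 / 2"
proof -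
  have "0\<^sup>2 / 2 - \<omega> 0 \<le> t\<^sup>2 / 2 - \<omega> t"
  proof (rule DERIV_nonneg_imp_nondecreasing[OF assms])
    fix x :: real assume x: "0 \<le> x" "x \<le> t"
    have "((\<lambda>t. t\<^sup>2 / 2 - \<omega> t) has_real_derivative x\<^sup>2 / (1 + x)) (at x)"
      unfolding \<omega>_def
      using x by (auto intro!: derivative_eq_intros simp: field_simps power2_eq_square)
    moreover have "0 \<le> x\<^sup>2 / (1 + x)" using x by simp
    ultimately show "\<exists>y. ((\<lambda>t. t\<^sup>2 / 2 - \<omega> t) has_real_derivative y) (at x) \<and> 0 \<le> y"
      by blast
  qed
  then show ?thesis by (simp add: \<omega>_def)
qed

lemma half_square_le_omega:
  assumes "-1 < t" "t \<le> 0"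
  shows "t\<^sup>2 / 2 \<le> \<omega> t"
proof -
  have "\<omega> t - t\<^sup>2 / 2 \<ge> \<omega> 0 - 0\<^sup>2 / 2"
  proof (rule DERIV_nonpos_imp_nonincreasing[OF assms(2)])
    fix x :: real assume x: "t \<le> x" "x \<le> 0"
    have "((\<lambda>t. \<omega> t - t\<^sup>2 / 2) has_real_derivative - (x\<^sup>2 / (1 + x))) (at x)"
      unfolding \<omega>_def
      using x assms by (auto intro!: derivative_eq_intros simp: field_simps power2_eq_square)
    moreover have "0 \<le> x\<^sup>2 / (1 + x)" using x assms by simp
    ultimately show "\<exists>y. ((\<lambda>t. \<omega> t - t\<^sup>2 / 2) has_real_derivative y) (at x) \<and> y \<le> 0"
      by (meson neg_le_0_iff_le)
  qed
  then show ?thesis by (simp add: \<omega>_def)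
qed

text \<open>Up to a positive denominator, the derivative of the quotient is \<open>x\<close> times
  \<open>2 * ln u - (u - 1 / u)\<close> with \<open>u = 1 + x\<close>, which
  \<open>two_ln_le_diff_inverse\<close> makes nonpositive.\<close>

lemma omega_div_square_antimono_pos:
  assumes "0 < s" "s \<le> t"
  shows "\<omega> t / t\<^sup>2 \<le> \<omega> s / s\<^sup>2"
proof (rule DERIV_nonpos_imp_nonincreasing[OF assms(2)])
  fix x :: real assume x: "s \<le> x" "x \<le> t"
  define D where "D = ((1 - 1 / (1 + x)) * x\<^sup>2 - \<omega> x * (2 * x)) / (x\<^sup>2 * x\<^sup>2)"
  have "((\<lambda>t. \<omega> t / t\<^sup>2) has_real_derivative D) (at x)"
    unfolding \<omega>_def D_def
    using x assms by (auto intro!: derivative_eq_intros)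
  moreover have "D \<le> 0"
  proof -
    have "(1 - 1 / (1 + x)) * x\<^sup>2 - \<omega> x * (2 * x) = x * (2 * ln (1 + x) - (1 + x - 1 / (1 + x)))"
      using x assms by (simp add: \<omega>_def field_simps power2_eq_square)
    also have "\<dots> \<le> 0"
      using two_ln_le_diff_inverse[of "1 + x"] x assms by (intro mult_nonneg_nonpos) auto
    finally show ?thesis by (simp add: D_def divide_nonpos_nonneg)
  qed
  ultimately show "\<exists>y. ((\<lambda>t. \<omega> t / t\<^sup>2) has_real_derivative y) (at x) \<and> y \<le> 0"
    by blast
qed

text \<open>Monotonicity of \<open>\<omega> t / t\<^sup>2\<close> is carried across the removable
  singularity at 0 by its limit there, 1/2: values at positive arguments lie below it, values at
  negative arguments above.\<close>

lemma omega_quadratic_lower_bound: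
  assumes "-1 < s" "s \<le> t" "0 < t"
  shows "\<omega> t / t\<^sup>2 * s\<^sup>2 \<le> \<omega> s"
proof (cases "0 < s")
  case True
  then show ?thesis
    using omega_div_square_antimono_pos[of s t] assms by (simp add: pos_le_divide_eq)
next
  case False
  have "\<omega> t / t\<^sup>2 \<le> 1 / 2"
    using omega_le_half_square[of t] assms by (simp add: field_simps)
  then have "\<omega> t / t\<^sup>2 * s\<^sup>2 \<le> 1 / 2 * s\<^sup>2"
    by (rule mult_right_mono) simp
  also have "\<dots> \<le> \<omega> s"
    using half_square_le_omega[of s] assms False by simp
  finally show ?thesis .
qed

section \<open>Maximizers of \<open>fbar\<close> over a set in the nonnegative orthant\<close>

lemma fbar_eq_ereal:
  assumes "\<And>j. 0 < y $ j"
  shows "fbar p y = ereal (\<Sum>j\<in>UNIV. p $ j * ln (y $ j))"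
  using assms by (simp add: fbar_def eln_def)

lemma fbar_eq_MInf:
  fixes y :: "real ^ 'm"
  assumes p: "\<And>j. 0 < p $ j" and k: "y $ k \<le> 0"
  shows "fbar p y = -\<infinity>"
proof -
  \<comment> \<open>In \<open>ereal\<close>, \<open>\<infinity>\<close> absorbs
    \<open>-\<infinity>\<close> in a sum, so a single infinite negative summand decides the value
    only once no other summand is \<open>\<infinity>\<close>.\<close>
  have "ereal (p $ j) * eln (y $ j) \<noteq> \<infinity>" for j
    using p[of j] by (auto simp: eln_def)
  then have "(\<Sum>j\<in>UNIV - {k}. ereal (p $ j) * eln (y $ j)) \<noteq> \<infinity>"
    by (simp add: sum_Pinfty)
  moreover have "ereal (p $ k) * eln (y $ k) = -\<infinity>"
    using p[of k] k by (simp add: eln_def)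
  ultimately show ?thesis
    unfolding fbar_def by (subst sum.remove[of _ k]) auto
qed

lemma exists_positive_fbar_maximizer:
  fixes Y :: "(real ^ 'm) set"
  assumes p: "\<And>j. 0 < p $ j" and "compact Y"
    and nonneg: "\<And>y j. y \<in> Y \<Longrightarrow> 0 \<le> y $ j"
    and y0: "y0 \<in> Y" "\<And>j. 0 < y0 $ j"
  obtains y where "y \<in> Y" "\<And>j. 0 < y $ j" "\<And>z. z \<in> Y \<Longrightarrow> fbar p z \<le> fbar p y"
proof -
  define G where "G = (\<lambda>y :: real ^ 'm. \<Prod>j\<in>UNIV. (y $ j) powr (p $ j))"
  have "continuous_on Y G"
    unfolding G_def
    by (intro continuous_on_prod continuous_on_powr' continuous_intros)
      (use p nonneg in \<open>auto simp: less_imp_le\<close>)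
  then obtain y where y: "y \<in> Y" and max: "\<And>z. z \<in> Y \<Longrightarrow> G z \<le> G y"
    using continuous_attains_sup[of Y G] \<open>compact Y\<close> y0(1) by blast
  \<comment> \<open>The positive point \<open>y0\<close> makes the maximum of \<open>G\<close>
    positive. Since a zero entry would make the product vanish, the maximizer avoids the
    boundary.\<close>
  have "0 < G y0" unfolding G_def using y0(2) by (intro prod_pos) (simp add: less_imp_neq[symmetric])
  then have "G y \<noteq> 0" using max[OF y0(1)] by linarith
  then have pos: "0 < y $ j" for j
  proof -
    have "(y $ j) powr (p $ j) \<noteq> 0"
      using \<open>G y \<noteq> 0\<close> unfolding G_def by (subst (asm) prod_zero_iff) auto
    then show ?thesis using nonneg[OF y, of j] by (cases "y $ j = 0") auto
  qed
  have lnG: "fbar p z = ereal (ln (G z))" if "\<And>j. 0 < z $ j" for z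
  proof -
    have "ln (G z) = (\<Sum>j\<in>UNIV. p $ j * ln (z $ j))"
      unfolding G_def using that by (subst ln_prod) (auto simp: ln_powr less_imp_neq[symmetric])
    then show ?thesis using that by (simp add: fbar_eq_ereal)
  qed
  have "fbar p z \<le> fbar p y" if z: "z \<in> Y" for z
  proof (cases "\<forall>j. 0 < z $ j")
    case True
    then have "0 < G z" unfolding G_def by (intro prod_pos) (simp add: less_imp_neq[symmetric])
    then have "ln (G z) \<le> ln (G y)" using max[OF z] by simp
    then show ?thesis using True pos by (simp add: lnG)
  next
    case False
    then show ?thesis using fbar_eq_MInf[OF p] by (metis MInfty_eq_minfinity ereal_less_eq(2) not_le)
  qed
  with y pos that show thesis by blast
qed

text \<open>The sum is the derivative at 0 of the objective along the segment from \<open>y\<close>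
  to \<open>z\<close>. Were it positive, a short move towards \<open>z\<close> would beat the
  maximum.\<close>

lemma fbar_maximizer_first_order:
  fixes Y :: "(real ^ 'm) set"
  assumes "convex Y" and nonneg: "\<And>y j. y \<in> Y \<Longrightarrow> 0 \<le> y $ j"
    and y: "y \<in> Y" "\<And>j. 0 < y $ j" and max: "\<And>z. z \<in> Y \<Longrightarrow> fbar p z \<le> fbar p y"
    and z: "z \<in> Y"
  shows "(\<Sum>j\<in>UNIV. p $ j * ((z $ j - y $ j) / y $ j)) \<le> 0"
proof (rule ccontr)
  define g where "g = (\<lambda>t. \<Sum>j\<in>UNIV. p $ j * ln (y $ j + t * (z $ j - y $ j)))"
  assume "\<not> ?thesis"
  moreover have "(g has_real_derivative (\<Sum>j\<in>UNIV. p $ j * ((z $ j - y $ j) / y $ j))) (at 0)"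
    unfolding g_def
  proof (rule DERIV_sum)
    fix j
    show "((\<lambda>t. p $ j * ln (y $ j + t * (z $ j - y $ j))) has_real_derivative
        p $ j * ((z $ j - y $ j) / y $ j)) (at 0)"
      using y(2)[of j] by (auto intro!: derivative_eq_intros)
  qed
  ultimately have "\<exists>d>0. \<forall>h>0. h < d \<longrightarrow> g 0 < g (0 + h)"
    by (intro DERIV_pos_inc_right) (auto simp only: not_le)
  then obtain d where d: "0 < d" "\<And>h. 0 < h \<Longrightarrow> h < d \<Longrightarrow> g 0 < g h"
    by auto
  \<comment> \<open>Staying below \<open>d\<close> keeps the strict increase. Staying below 1 leaves
    a positive share of \<open>y\<close>, so \<open>w\<close> is positive even where
    \<open>z\<close> has zero entries.\<close>
  define t where "t = min (1/2) (d/2)"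
  have t: "0 < t" "t < 1" "t < d" using d(1) by (auto simp: t_def)
  define w where "w = y + t *\<^sub>R (z - y)"
  have wY: "w \<in> Y"
    using convexD_alt[OF \<open>convex Y\<close> y(1) z, of t] t by (simp add: w_def algebra_simps)
  have "w $ j = (1 - t) * y $ j + t * z $ j" for j
    by (simp add: w_def algebra_simps)
  then have wpos: "0 < w $ j" for j
    using t y(2)[of j] nonneg[OF z, of j] by (simp add: add_pos_nonneg)
  have "g t \<le> g 0"
    using max[OF wY] wpos y(2) by (simp add: fbar_eq_ereal g_def w_def)
  with d(2)[of t] t show False by simp
qed

text \<open>With \<open>d j\<close> the relative deviation, \<open>1 + d j\<close> is
  \<open>z $ j / y $ j\<close>, so the two sides differ exactly by the linear term, whose sign is
  known from first-order optimality.\<close>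

lemma sum_omega_le_fbar_gap:
  fixes Y :: "(real ^ 'm) set"
  assumes "convex Y" and nonneg: "\<And>y j. y \<in> Y \<Longrightarrow> 0 \<le> y $ j"
    and y: "y \<in> Y" "\<And>j. 0 < y $ j" and max: "\<And>z. z \<in> Y \<Longrightarrow> fbar p z \<le> fbar p y"
    and z: "z \<in> Y" "\<And>j. 0 < z $ j"
  shows "(\<Sum>j\<in>UNIV. p $ j * \<omega> ((z $ j - y $ j) / y $ j))
    \<le> (\<Sum>j\<in>UNIV. p $ j * ln (y $ j)) - (\<Sum>j\<in>UNIV. p $ j * ln (z $ j))"
proof -
  have "\<omega> ((z $ j - y $ j) / y $ j) = (z $ j - y $ j) / y $ j - (ln (z $ j) - ln (y $ j))" for j
  proof -
    have "1 + (z $ j - y $ j) / y $ j = z $ j / y $ j"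
      using y(2)[of j] by (simp add: field_simps)
    then show ?thesis using y(2)[of j] z(2)[of j] by (simp add: \<omega>_def ln_div)
  qed
  then have "(\<Sum>j\<in>UNIV. p $ j * \<omega> ((z $ j - y $ j) / y $ j))
      = (\<Sum>j\<in>UNIV. p $ j * ((z $ j - y $ j) / y $ j))
        + (\<Sum>j\<in>UNIV. p $ j * ln (y $ j)) - (\<Sum>j\<in>UNIV. p $ j * ln (z $ j))"
    by (simp add: right_diff_distrib sum_subtractf)
  then show ?thesis
    using fbar_maximizer_first_order[OF assms(1,2) y max z(1)] by simp
qed

text \<open>A second maximizer has zero gap, which forces every nonnegative term
  \<open>p $ j * \<omega> (d j)\<close> to vanish; \<open>\<omega>\<close> is zero only at
  0.\<close>

lemma fbar_maximizer_unique:
  fixes Y :: "(real ^ 'm) set"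
  assumes "convex Y" and p: "\<And>j. 0 < p $ j" and nonneg: "\<And>y j. y \<in> Y \<Longrightarrow> 0 \<le> y $ j"
    and y: "y \<in> Y" "\<And>j. 0 < y $ j" and max: "\<And>z. z \<in> Y \<Longrightarrow> fbar p z \<le> fbar p y"
    and z: "z \<in> Y" and le: "fbar p y \<le> fbar p z"
  shows "z = y"
proof -
  have zpos: "0 < z $ j" for j
  proof (rule ccontr)
    assume "\<not> 0 < z $ j"
    then have "fbar p z = -\<infinity>" using fbar_eq_MInf[OF p, where k = j] by simp
    with le show False using y(2) by (simp add: fbar_eq_ereal)
  qed
  define d where "d j = (z $ j - y $ j) / y $ j" for j
  have d: "-1 < d j" for j
    using y(2)[of j] zpos[of j] by (simp add: d_def field_simps)
  have "(\<Sum>j\<in>UNIV. p $ j * \<omega> (d j)) \<le> 0"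
    using sum_omega_le_fbar_gap[OF assms(1,3) y max z zpos] le zpos y(2)
    by (simp add: fbar_eq_ereal d_def)
  moreover have nn: "0 \<le> p $ j * \<omega> (d j)" for j
    using p[of j] omega_nonneg[OF d[of j]] by simp
  ultimately have "(\<Sum>j\<in>UNIV. p $ j * \<omega> (d j)) = 0"
    by (intro antisym sum_nonneg)
  then have eq0: "p $ j * \<omega> (d j) = 0" for j
    using nn by (simp add: sum_nonneg_eq_0_iff)
  have "z $ j = y $ j" for j
  proof -
    have "\<omega> (d j) = 0" using eq0[of j] p[of j] by simp
    then have "d j = 0" using omega_eq_0_iff[OF d[of j]] by simp
    then show ?thesis using y(2)[of j] by (simp add: d_def)
  qed
  then show ?thesis by (simp add: vec_eq_iff)
qed

section \<open>The simplex, its image under \<open>A\<close>, and \<open>ystar\<close>\<close>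

lemma compact_prob_simplex: "compact (prob_simplex :: (real ^ 'n) set)"
proof -
  have "prob_simplex = (\<Inter>i. {x :: real ^ 'n. 0 \<le> x $ i}) \<inter> {x. (\<Sum>i\<in>UNIV. x $ i) = 1}"
    by (auto simp: prob_simplex_def)
  moreover have "closed \<dots>"
    by (intro closed_Int closed_INT ballI closed_Collect_le closed_Collect_eq continuous_intros)
  moreover have "bounded (prob_simplex :: (real ^ 'n) set)"
  proof (rule boundedI)
    fix x :: "real ^ 'n" assume x: "x \<in> prob_simplex"
    have "norm x \<le> (\<Sum>i\<in>UNIV. \<bar>x $ i\<bar>)" by (rule norm_le_l1_cart)
    then show "norm x \<le> 1" using x by (simp add: prob_simplex_def)
  qed
  ultimately show ?thesis by (simp add: compact_eq_bounded_closed)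
qed

lemma convex_prob_simplex: "convex prob_simplex"
proof (rule convexI)
  fix x y :: "real ^ 'n" and u v :: real
  assume "x \<in> prob_simplex" "y \<in> prob_simplex" "0 \<le> u" "0 \<le> v" "u + v = 1"
  then show "u *\<^sub>R x + v *\<^sub>R y \<in> prob_simplex"
    by (simp add: prob_simplex_def sum.distrib flip: sum_distrib_left)
qed

lemma compact_Yset: "compact (Yset A)"
  unfolding Yset_def
  by (intro compact_continuous_image compact_prob_simplex linear_continuous_on
      matrix_vector_mul_bounded_linear)

lemma convex_Yset: "convex (Yset A)"
  unfolding Yset_def by (intro convex_linear_image convex_prob_simplex matrix_vector_mul_linear)

lemma Yset_nonneg:
  assumes "\<And>j i. 0 \<le> A $ j $ i" "y \<in> Yset A"
  shows "0 \<le> y $ j"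
  using assms by (auto simp: Yset_def prob_simplex_def matrix_vector_mult_def intro!: sum_nonneg)

lemma exists_positive_Yset:
  fixes A :: "real ^ 'n ^ 'm"
  assumes nonneg: "\<And>j i. 0 \<le> A $ j $ i" and nonzero: "\<And>j. A $ j \<noteq> 0"
  obtains y where "y \<in> Yset A" "\<And>j. 0 < y $ j"
proof -
  \<comment> \<open>The barycenter has only positive entries, so every nonnegative nonzero row pairs
    positively with it.\<close>
  define u :: "real ^ 'n" where "u = (\<chi> i. 1 / real CARD('n))"
  have "u \<in> prob_simplex" by (simp add: u_def prob_simplex_def)
  moreover have "0 < (A *v u) $ j" for j
  proof -
    obtain i where "A $ j $ i \<noteq> 0" using nonzero[of j] by (auto simp: vec_eq_iff)
    then have "0 < A $ j $ i * u $ i" using nonneg[of j i] by (simp add: u_def)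
    then show ?thesis
      unfolding matrix_vector_mult_def vec_lambda_beta
      by (intro sum_pos2[where i = i]) (auto simp: u_def nonneg)
  qed
  ultimately show thesis using that by (auto simp: Yset_def)
qed

lemma fobj_eq_fbar: "fobj p A x = fbar p (A *v x)"
  by (simp add: fobj_def fbar_def matrix_vector_mul_component)

text \<open>\<open>ystar\<close> is a definite description, so its properties become available only
  after existence and uniqueness of the maximizer. The rows being nonnegative and nonzero supplies
  the positive point that existence requires.\<close>

lemma
  fixes A :: "real ^ 'n ^ 'm"
  assumes p: "\<And>j. 0 < p $ j" and A: "\<And>j i. 0 \<le> A $ j $ i" "\<And>j. A $ j \<noteq> 0"
  shows ystar_in_Yset: "ystar p A \<in> Yset A"
    and ystar_pos: "0 < ystar p A $ j"
    and fbar_le_fbar_ystar: "z \<in> Yset A \<Longrightarrow> fbar p z \<le> fbar p (ystar p A)"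
proof -
  obtain y0 where "y0 \<in> Yset A" "\<And>j. 0 < y0 $ j"
    using exists_positive_Yset[OF A] by blast
  then obtain y where y: "y \<in> Yset A" "\<And>j. 0 < y $ j"
    and max: "\<And>z. z \<in> Yset A \<Longrightarrow> fbar p z \<le> fbar p y"
    using exists_positive_fbar_maximizer[OF p compact_Yset Yset_nonneg[OF A(1)]] by metis
  have "ystar p A = y"
    unfolding ystar_def
  proof (rule the_equality)
    show "is_arg_max (fbar p) (\<lambda>y. y \<in> Yset A) y"
      using y max by (auto simp: is_arg_max_def not_less)
  next
    fix z assume "is_arg_max (fbar p) (\<lambda>y. y \<in> Yset A) z"
    then have "z \<in> Yset A" "fbar p y \<le> fbar p z"
      using y by (auto simp: is_arg_max_def not_less)
    then show "z = y"
      using fbar_maximizer_unique[OF convex_Yset p Yset_nonneg[OF A(1)] y max] by blast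
  qed
  with y max show "ystar p A \<in> Yset A" "0 < ystar p A $ j"
    "z \<in> Yset A \<Longrightarrow> fbar p z \<le> fbar p (ystar p A)" by auto
qed

lemma fstar_eq_fbar_ystar:
  fixes A :: "real ^ 'n ^ 'm"
  assumes "\<And>j. 0 < p $ j" "\<And>j i. 0 \<le> A $ j $ i" "\<And>j. A $ j \<noteq> 0"
  shows "fstar p A = fbar p (ystar p A)"
proof -
  have "fstar p A = (SUP y\<in>Yset A. fbar p y)"
    by (simp add: fstar_def Yset_def fobj_eq_fbar image_image)
  also have "\<dots> = fbar p (ystar p A)"
    using fbar_le_fbar_ystar[OF assms] ystar_in_Yset[OF assms]
    by (intro antisym SUP_least SUP_upper)
  finally show ?thesis .
qed

section \<open>The radius and the quadratic growth of the gap\<close>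

lemma local_norm_le_radius:
  assumes "y \<in> Yset A" and "\<And>j. 0 < ystar p A $ j"
  shows "local_norm p (ystar p A) (y - ystar p A) \<le> radius p A"
  unfolding radius_def
proof (rule cSUP_upper[OF assms(1)])
  \<comment> \<open>A real supremum bounds its members only when the set is bounded above;
    compactness of the image provides this.\<close>
  have "continuous_on (Yset A) (\<lambda>y. local_norm p (ystar p A) (y - ystar p A))"
    unfolding local_norm_def
    by (intro continuous_intros) (use assms(2) in \<open>auto simp: less_imp_neq[symmetric]\<close>)
  then show "bdd_above ((\<lambda>y. local_norm p (ystar p A) (y - ystar p A)) ` Yset A)"
    by (intro bounded_imp_bdd_above compact_imp_bounded compact_continuous_image compact_Yset)
qed

lemma pmin_le: "pmin p \<le> p $ j"
  by (simp add: pmin_def)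

lemma pmin_pos:
  assumes "\<And>j. 0 < p $ j"
  shows "0 < pmin p"
  using assms by (auto simp: pmin_def)

text \<open>One summand of the squared local norm is at most the whole, and its weight is at least
  \<open>pmin p\<close>.\<close>

lemma component_le_radius:
  fixes A :: "real ^ 'n ^ 'm"
  assumes p: "\<And>j. 0 < p $ j" and y: "y \<in> Yset A" and pos: "\<And>j. 0 < ystar p A $ j"
  shows "(y $ j - ystar p A $ j) / ystar p A $ j \<le> radius p A / sqrt (pmin p)"
proof -
  define d where "d j = (y $ j - ystar p A $ j) / ystar p A $ j" for j
  have "pmin p * (d j)\<^sup>2 \<le> p $ j * (d j)\<^sup>2"
    by (intro mult_right_mono pmin_le) simp
  also have "\<dots> \<le> (\<Sum>j\<in>UNIV. p $ j * (d j)\<^sup>2)"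
    by (rule member_le_sum) (auto simp: p less_imp_le)
  finally have "sqrt (pmin p * (d j)\<^sup>2) \<le> local_norm p (ystar p A) (y - ystar p A)"
    by (simp add: local_norm_def d_def)
  also have "\<dots> \<le> radius p A" by (rule local_norm_le_radius[OF y pos])
  finally have "sqrt (pmin p) * \<bar>d j\<bar> \<le> radius p A" by (simp add: real_sqrt_mult)
  then have "\<bar>d j\<bar> \<le> radius p A / sqrt (pmin p)"
    using pmin_pos[OF p] by (simp add: pos_le_divide_eq mult.commute)
  then show ?thesis unfolding d_def by linarith
qed

lemma local_norm_le_fbar_gap:
  fixes A :: "real ^ 'n ^ 'm"
  assumes p: "\<And>j. 0 < p $ j" and A: "\<And>j i. 0 \<le> A $ j $ i" "\<And>j. A $ j \<noteq> 0"
    and y: "y \<in> Yset A" "\<And>j. 0 < y $ j" and R: "0 < radius p A"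
  shows "pmin p * \<omega> (radius p A / sqrt (pmin p)) * (local_norm p (ystar p A) (y - ystar p A))\<^sup>2
    \<le> (radius p A)\<^sup>2 * ((\<Sum>j\<in>UNIV. p $ j * ln (ystar p A $ j)) - (\<Sum>j\<in>UNIV. p $ j * ln (y $ j)))"
proof -
  define T where "T = radius p A / sqrt (pmin p)"
  define d where "d j = (y $ j - ystar p A $ j) / ystar p A $ j" for j
  note pos = ystar_pos[OF p A]
  have T: "0 < T" using R pmin_pos[OF p] by (simp add: T_def)
  have "\<omega> T / T\<^sup>2 * (d j)\<^sup>2 \<le> \<omega> (d j)" for j
  proof (rule omega_quadratic_lower_bound)
    show "-1 < d j" using pos[of j] y(2)[of j] by (simp add: d_def field_simps)
    show "d j \<le> T" unfolding d_def T_def by (rule component_le_radius[OF p y(1) pos])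
  qed (rule T)
  then have "p $ j * (\<omega> T / T\<^sup>2 * (d j)\<^sup>2) \<le> p $ j * \<omega> (d j)" for j
    using p[of j] by (intro mult_left_mono) auto
  then have "(\<Sum>j\<in>UNIV. p $ j * (\<omega> T / T\<^sup>2 * (d j)\<^sup>2)) \<le> (\<Sum>j\<in>UNIV. p $ j * \<omega> (d j))"
    by (intro sum_mono)
  also have "\<dots> \<le> (\<Sum>j\<in>UNIV. p $ j * ln (ystar p A $ j)) - (\<Sum>j\<in>UNIV. p $ j * ln (y $ j))"
    unfolding d_def
    by (rule sum_omega_le_fbar_gap[OF convex_Yset Yset_nonneg[OF A(1)] ystar_in_Yset[OF p A] pos
          fbar_le_fbar_ystar[OF p A] y])
  also have "(\<Sum>j\<in>UNIV. p $ j * (\<omega> T / T\<^sup>2 * (d j)\<^sup>2)) = \<omega> T / T\<^sup>2 * (\<Sum>j\<in>UNIV. p $ j * (d j)\<^sup>2)"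
    by (simp add: sum_distrib_left mult_ac)
  also have "(\<Sum>j\<in>UNIV. p $ j * (d j)\<^sup>2) = (local_norm p (ystar p A) (y - ystar p A))\<^sup>2"
    using p by (simp add: local_norm_def d_def sum_nonneg less_imp_le)
  \<comment> \<open>Here \<open>T\<^sup>2\<close> equals
    \<open>(radius p A)\<^sup>2 / pmin p\<close>.\<close>
  also have "\<omega> T / T\<^sup>2 = pmin p * \<omega> T / (radius p A)\<^sup>2"
    using pmin_pos[OF p] by (simp add: T_def power_divide)
  finally show ?thesis
    using R by (simp add: T_def field_simps)
qed

text \<open>The factor has \<open>C_H\<close> and the radius in the numerator, since it combines
  \<open>dist \<le> C_H * r\<close> with \<open>r \<le> R / sqrt W * sqrt D\<close>. It is the
  reciprocal of the factor in the opening English statement. That one cannot hold in general: any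
  larger \<open>C_H\<close> is again a Hoffman constant, so it would force distance 0 wherever the
  gap is finite.\<close>

theorem proposition1:
  fixes p :: "real ^ 'm" and A :: "real ^ 'n ^ 'm"
    and N :: "real ^ 'n \<Rightarrow> real" and C_H :: real
  assumes p_pos: "\<And>j. 0 < p $ j" and p_sum: "(\<Sum>j\<in>UNIV. p $ j) = 1"
    and A_nonneg: "\<And>j i. 0 \<le> A $ j $ i" and A_nonzero: "\<And>j. A $ j \<noteq> 0"
    and norm: "is_norm N"
    and C_pos: "0 < C_H"
    and hoffman: "\<And>x. x \<in> prob_simplex \<Longrightarrow>
      norm_dist N x (Xstar p A) \<le> C_H * local_norm p (ystar p A) (A *v x - ystar p A)"
  shows "\<forall>x\<in>prob_simplex. ereal (norm_dist N x (Xstar p A)) \<le>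
    ereal (C_H * radius p A / sqrt (pmin p * \<omega> (radius p A / sqrt (pmin p))))
      * esqrt (fstar p A - fobj p A x)"
proof
  fix x :: "real ^ 'n" assume x: "x \<in> prob_simplex"
  define y where "y = A *v x"
  define r where "r = local_norm p (ystar p A) (y - ystar p A)"
  define R where "R = radius p A"
  define W where "W = pmin p * \<omega> (R / sqrt (pmin p))"
  have y: "y \<in> Yset A" using x by (simp add: y_def Yset_def)
  note pos = ystar_pos[OF p_pos A_nonneg A_nonzero]
  have dist: "norm_dist N x (Xstar p A) \<le> C_H * r"
    using hoffman[OF x] by (simp add: r_def y_def)
  have r0: "0 \<le> r"
    using p_pos by (simp add: r_def local_norm_def sum_nonneg less_imp_le)
  have rR: "r \<le> R"
    unfolding r_def R_def by (rule local_norm_le_radius[OF y pos])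
  \<comment> \<open>Only the value at \<open>ystar\<close> is known to be finite;
    \<open>fbar p y\<close> may still be \<open>-\<infinity>\<close>.\<close>
  have gap: "fstar p A - fobj p A x = ereal (\<Sum>j\<in>UNIV. p $ j * ln (ystar p A $ j)) - fbar p y"
    using fstar_eq_fbar_ystar[OF p_pos A_nonneg A_nonzero] pos
    by (simp add: fbar_eq_ereal fobj_eq_fbar y_def)
  have "ereal (norm_dist N x (Xstar p A)) \<le>
      ereal (C_H * R / sqrt W) * esqrt (fstar p A - fobj p A x)"
  proof (cases "R = 0")
    \<comment> \<open>In this degenerate case \<open>W\<close> is 0 as well, but the numerator makes
      the factor 0, so the right side is 0. The distance is at most 0 because \<open>r\<close> is
      squeezed between 0 and \<open>R\<close>.\<close>
    case True
    then have "norm_dist N x (Xstar p A) \<le> 0" using dist r0 rR by simp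
    then show ?thesis using True by (simp flip: zero_ereal_def)
  next
    case False
    then have R: "0 < R" using r0 rR by simp
    then have "0 < R / sqrt (pmin p)" using pmin_pos[OF p_pos] by simp
    then have "0 < \<omega> (R / sqrt (pmin p))"
      using omega_nonneg[of "R / sqrt (pmin p)"] omega_eq_0_iff[of "R / sqrt (pmin p)"] by linarith
    then have W: "0 < W" using pmin_pos[OF p_pos] by (simp add: W_def)
    show ?thesis
    proof (cases "\<forall>j. 0 < y $ j")
      case True
      define D where
        "D = (\<Sum>j\<in>UNIV. p $ j * ln (ystar p A $ j)) - (\<Sum>j\<in>UNIV. p $ j * ln (y $ j))"
      have "W * r\<^sup>2 \<le> R\<^sup>2 * D"
        using local_norm_le_fbar_gap[OF p_pos A_nonneg A_nonzero y] True R
        by (simp add: W_def R_def D_def r_def)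
      then have "sqrt (W * r\<^sup>2) \<le> sqrt (R\<^sup>2 * D)" by simp
      then have "sqrt W * r \<le> R * sqrt D" using r0 R by (simp add: real_sqrt_mult)
      then have "r \<le> R / sqrt W * sqrt D" using W by (simp add: field_simps)
      then have "C_H * r \<le> C_H * (R / sqrt W * sqrt D)"
        using C_pos by (intro mult_left_mono) auto
      moreover have "fstar p A - fobj p A x = ereal D"
        using gap True by (simp add: fbar_eq_ereal D_def)
      ultimately show ?thesis using dist by (simp add: esqrt_def)
    next
      case False
      then obtain k where "y $ k \<le> 0" by (auto simp: not_less)
      \<comment> \<open>On the boundary the gap is infinite, and the positive factor keeps the right
        side infinite.\<close>
      then have "fstar p A - fobj p A x = \<infinity>"
        using gap by (simp add: fbar_eq_MInf[OF p_pos])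
      then show ?thesis using C_pos R W by (simp add: esqrt_def)
    qed
  qed
  then show "ereal (norm_dist N x (Xstar p A)) \<le>
    ereal (C_H * radius p A / sqrt (pmin p * \<omega> (radius p A / sqrt (pmin p))))
      * esqrt (fstar p A - fobj p A x)"
    by (simp add: W_def R_def)
qed

end
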